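(* Let $k$ be a commutative ring with $\mathbb{Q}\subseteq k$, let $(A,\mu_0)$ be a coisotropic $k$-algebra, and let $\mu^{(r)}=\mu_0+\lambda\mu_1+\cdots+\lambda^r\mu_r$ with $\mu_1,\dots,\mu_r\in C^2(A)_N$ be an associative deformation of $\mu_0$ up to order $r$. Then $$R_{r+1}=\Big(\tfrac12\sum_{\ell=1}^{r}\big[(\mu_\ell)_{\mathrm{tot}},(\mu_{r+1-\ell})_{\mathrm{tot}}\big]^{A_{\mathrm{tot}}},\ \tfrac12\sum_{\ell=1}^{r}\big[(\mu_\ell)_N,(\mu_{r+1-\ell})_N\big]^{A_N}\Big)\in C^3(A)_N$$ is a coisotropic Hochschild cocycle, i.e. $\delta_N R_{r+1}=0$. The deformation $\mu^{(r)}$ can be extended to order $r+1$ if and only if $R_{r+1}=\delta_N\mu_{r+1}$ for some $\mu_{r+1}\in C^2(A)_N$. In this case every such $\mu_{r+1}$ yields an extension $\mu^{(r+1)}=\mu^{(r)}+\lambda^{r+1}\mu_{r+1}$.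
   Context: A coisotropic $k$-algebra $(A,\mu_0)$ consists of unital associative $k$-algebras $A_{\mathrm{tot}},A_N$, a unital algebra homomorphism $\iota_A\colon A_N\to A_{\mathrm{tot}}$ and a two-sided ideal $A_0\subseteq A_N$; $\mu_0=((\mu_0)_{\mathrm{tot}},(\mu_0)_N)$ denotes the pair of multiplications. $C^n(A)_N$ is the $k$-module of pairs $f=(f_{\mathrm{tot}},f_N)$ of $k$-multilinear maps $f_{\mathrm{tot}}\colon A_{\mathrm{tot}}^{\otimes n}\to A_{\mathrm{tot}}$, $f_N\colon A_N^{\otimes n}\to A_N$ with $f_{\mathrm{tot}}\circ\iota_A^{\otimes n}=\iota_A\circ f_N$ and $f_N(a_1,\dots,a_n)\in A_0$ whenever at least one $a_i\in A_0$. In particular $\mu_0\in C^2(A)_N$. $[\cdot,\cdot]^{A_{\mathrm{tot}}}$ and $[\cdot,\cdot]^{A_N}$ are the Gerstenhaber brackets on multilinear maps on $A_{\mathrm{tot}}$, respectively $A_N$: for an $m$-cochain $f$ and an $n$-cochain $g$, $[f,g]=f\circ g-(-1)^{(m-1)(n-1)}g\circ f$, with $(f\circ g)(a_1,\dots,a_{m+n-1})=\sum_{i=0}^{m-1}(-1)^{i(n-1)}f(a_1,\dots,a_i,g(a_{i+1},\dots,a_{i+n}),a_{i+n+1},\dots,a_{m+n-1})$. The bracket $[\cdot,\cdot]_N$ on $C^\bullet(A)_N$ is componentwise, and the Hochschild differential is $\delta_N=-[\cdot,\mu_0]_N$, i.e. the pair of the usual Hochschild differentials of $A_{\mathrm{tot}}$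 and $A_N$. An associative deformation of $\mu_0$ up to order $r$ is $\mu^{(r)}=\mu_0+\sum_{\ell=1}^r\lambda^\ell\mu_\ell$ with $\mu_\ell\in C^2(A)_N$ whose two components are associative modulo $\lambda^{r+1}$ (when extended $\lambda$-linearly). It can be extended to order $r+1$ if there is $\mu_{r+1}\in C^2(A)_N$ such that $\mu^{(r)}+\lambda^{r+1}\mu_{r+1}$ is an associative deformation of $\mu_0$ up to order $r+1$. *)

theory Defs
  imports
    "HOL-Library.Function_Algebras"
    "HOL-Library.Product_Plus"
    "HOL-Computational_Algebra.Formal_Power_Series"
begin

text \<open>
  The inclusion of the rational numbers into \<open>k\<close>; the scalar one half of \<open>k\<close> is \<open>q (1/2)\<close>.
\<close>

definition rat_embedding :: "(rat \<Rightarrow> 'k::comm_ring_1) \<Rightarrow> bool" where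
  "rat_embedding q \<longleftrightarrow> inj q \<and> q 1 = 1 \<and>
     (\<forall>x y. q (x + y) = q x + q y) \<and> (\<forall>x y. q (x * y) = q x * q y)"

text \<open>
  The sort \<open>{ring, monoid_mult}\<close> is used instead of \<open>ring_1\<close>, since the latter excludes the
  zero algebra.
\<close>

locale unital_algebra = module scale
  for scale :: "'k::comm_ring_1 \<Rightarrow> 'a::{ring, monoid_mult} \<Rightarrow> 'a" +
  assumes scale_mult_left: "scale c x * y = scale c (x * y)"
    and scale_mult_right: "x * scale c y = scale c (x * y)"

locale coisotropic_algebra =
  tot: unital_algebra scale_tot + N: unital_algebra scale_N + iota: module_hom scale_N scale_tot \<iota>
  for scale_tot :: "'k::comm_ring_1 \<Rightarrow> 'a::{ring, monoid_mult} \<Rightarrow> 'a"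
    and scale_N :: "'k \<Rightarrow> 'b::{ring, monoid_mult} \<Rightarrow> 'b"
    and \<iota> :: "'b \<Rightarrow> 'a" +
  fixes A0 :: "'b set"
  assumes iota_mult: "\<iota> (x * y) = \<iota> x * \<iota> y"
    and iota_one: "\<iota> 1 = 1"
    and A0_subspace: "N.subspace A0"
    and A0_left: "a \<in> A0 \<Longrightarrow> x * a \<in> A0"
    and A0_right: "a \<in> A0 \<Longrightarrow> a * x \<in> A0"

text \<open>
  An \<open>n\<close>-cochain on \<open>A\<close> is a function on lists of length \<open>n\<close>. It is required to vanish on lists of
  any other length, so that equality of cochains is equality of functions, and the \<open>k\<close>-module
  operations on cochains are the pointwise ones.
\<close>

definition multilinear :: "('k::comm_ring_1 \<Rightarrow> 'a::ab_group_add \<Rightarrow> 'a) \<Rightarrow> nat \<Rightarrow> ('a list \<Rightarrow> 'a) \<Rightarrow> bool"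
  where "multilinear scale n f \<longleftrightarrow>
    (\<forall>xs i. length xs = n \<longrightarrow> i < n \<longrightarrow> module_hom scale scale (\<lambda>x. f (xs[i := x]))) \<and>
    (\<forall>xs. length xs \<noteq> n \<longrightarrow> f xs = 0)"

definition mult_cochain :: "'a::{ring, monoid_mult} list \<Rightarrow> 'a" where
  "mult_cochain xs = (case xs of [x, y] \<Rightarrow> x * y | _ \<Rightarrow> 0)"

text \<open>
  \<open>signed e x\<close> is \<open>(-1)\<^sup>e x\<close>. The exponent is an integer because the shifted degrees \<open>m - 1\<close> and
  \<open>n - 1\<close> may be negative.
\<close>

definition signed :: "int \<Rightarrow> 'a::ab_group_add \<Rightarrow> 'a" where
  "signed e x = (if even e then x else - x)"

definition gerstenhaber_circ ::
  "nat \<Rightarrow> nat \<Rightarrow> ('a::ab_group_add list \<Rightarrow> 'a) \<Rightarrow> ('a list \<Rightarrow> 'a) \<Rightarrow> 'a list \<Rightarrow> 'a" where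
  "gerstenhaber_circ m n f g xs =
     (if length xs + 1 = m + n
      then \<Sum>i<m. signed (int i * (int n - 1))
                    (f (take i xs @ g (take n (drop i xs)) # drop (i + n) xs))
      else 0)"

definition gerstenhaber_bracket ::
  "nat \<Rightarrow> nat \<Rightarrow> ('a::ab_group_add list \<Rightarrow> 'a) \<Rightarrow> ('a list \<Rightarrow> 'a) \<Rightarrow> 'a list \<Rightarrow> 'a" where
  "gerstenhaber_bracket m n f g =
     gerstenhaber_circ m n f g - signed ((int m - 1) * (int n - 1)) (gerstenhaber_circ n m g f)"

type_synonym ('a, 'b) cochain_pair = "('a list \<Rightarrow> 'a) \<times> ('b list \<Rightarrow> 'b)"

definition bracket_N ::
  "nat \<Rightarrow> nat \<Rightarrow> ('a::ab_group_add, 'b::ab_group_add) cochain_pair \<Rightarrow> ('a, 'b) cochain_pair \<Rightarrow>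
   ('a, 'b) cochain_pair" where
  "bracket_N m n f g =
     (gerstenhaber_bracket m n (fst f) (fst g), gerstenhaber_bracket m n (snd f) (snd g))"

definition mu0 :: "('a::{ring, monoid_mult}, 'b::{ring, monoid_mult}) cochain_pair" where
  "mu0 = (mult_cochain, mult_cochain)"

definition delta_N ::
  "nat \<Rightarrow> ('a::{ring, monoid_mult}, 'b::{ring, monoid_mult}) cochain_pair \<Rightarrow> ('a, 'b) cochain_pair"
  where "delta_N n f = - bracket_N n 2 f mu0"

text \<open>
  The bilinear extension of \<open>\<mu>\<^sub>0 + \<lambda> \<mu>\<^sub>1 + \<dots> + \<lambda>\<^sup>r \<mu>\<^sub>r\<close> to formal power series in \<open>\<lambda>\<close> with
  coefficients in \<open>A\<close>, and its associativity modulo \<open>\<lambda>\<close> to the power \<open>r + 1\<close>.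
\<close>

definition lambda_ext ::
  "nat \<Rightarrow> (nat \<Rightarrow> 'a::ab_group_add list \<Rightarrow> 'a) \<Rightarrow> 'a fps \<Rightarrow> 'a fps \<Rightarrow> 'a fps" where
  "lambda_ext r \<mu> F G =
     Abs_fps (\<lambda>n. \<Sum>(l, i, j) | l \<le> r \<and> l + i + j = n. \<mu> l [fps_nth F i, fps_nth G j])"

definition assoc_up_to :: "nat \<Rightarrow> (nat \<Rightarrow> 'a::ab_group_add list \<Rightarrow> 'a) \<Rightarrow> bool" where
  "assoc_up_to r \<mu> \<longleftrightarrow>
     (\<forall>F G H. \<forall>n<r + 1.
        fps_nth (lambda_ext r \<mu> (lambda_ext r \<mu> F G) H) n =
        fps_nth (lambda_ext r \<mu> F (lambda_ext r \<mu> G H)) n)"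

context coisotropic_algebra
begin

definition C_N :: "nat \<Rightarrow> ('a, 'b) cochain_pair set" where
  "C_N n = {(f_tot, f_N).
     multilinear scale_tot n f_tot \<and> multilinear scale_N n f_N \<and>
     (\<forall>xs. length xs = n \<longrightarrow> f_tot (map \<iota> xs) = \<iota> (f_N xs)) \<and>
     (\<forall>xs. length xs = n \<longrightarrow> set xs \<inter> A0 \<noteq> {} \<longrightarrow> f_N xs \<in> A0)}"

text \<open>Only the values of \<open>\<mu>\<close> at \<open>0, \<dots>, r\<close> are used.\<close>

definition assoc_deformation :: "nat \<Rightarrow> (nat \<Rightarrow> ('a, 'b) cochain_pair) \<Rightarrow> bool" where
  "assoc_deformation r \<mu> \<longleftrightarrow>
     \<mu> 0 = mu0 \<and> (\<forall>l\<in>{1..r}. \<mu> l \<in> C_N 2) \<and>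
     assoc_up_to r (\<lambda>l. fst (\<mu> l)) \<and> assoc_up_to r (\<lambda>l. snd (\<mu> l))"

definition extendable :: "nat \<Rightarrow> (nat \<Rightarrow> ('a, 'b) cochain_pair) \<Rightarrow> bool" where
  "extendable r \<mu> \<longleftrightarrow> (\<exists>\<nu>\<in>C_N 2. assoc_deformation (r + 1) (\<mu>(r + 1 := \<nu>)))"

definition obstruction ::
  "(rat \<Rightarrow> 'k) \<Rightarrow> nat \<Rightarrow> (nat \<Rightarrow> ('a, 'b) cochain_pair) \<Rightarrow> ('a, 'b) cochain_pair" where
  "obstruction q r \<mu> =
     (\<lambda>xs. scale_tot (q (1/2))
        (\<Sum>l=1..r. gerstenhaber_bracket 2 2 (fst (\<mu> l)) (fst (\<mu> (r + 1 - l))) xs),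
      \<lambda>xs. scale_N (q (1/2))
        (\<Sum>l=1..r. gerstenhaber_bracket 2 2 (snd (\<mu> l)) (snd (\<mu> (r + 1 - l))) xs))"

end

end

theory Submission
  imports Defs
begin

text \<open>
  Let \<open>A\<^sub>n = \<Sum>i\<le>n. \<mu>\<^sub>i \<circ> \<mu>\<^sub>n\<^sub>-\<^sub>i\<close> be the coefficient of \<open>\<lambda>\<^sup>n\<close> in the associator of the deformed
  product; associativity up to order \<open>r\<close> means that \<open>A\<^sub>0, \<dots>, A\<^sub>r\<close> vanish. Since one half is a
  scalar, \<open>R\<close> equals \<open>\<Sum>l=1..r. \<mu>\<^sub>l \<circ> \<mu>\<^sub>r\<^sub>+\<^sub>1\<^sub>-\<^sub>l\<close>, whence \<open>A\<^sub>r\<^sub>+\<^sub>1 = R + [\<mu>\<^sub>r\<^sub>+\<^sub>1, \<mu>\<^sub>0]\<close>, which vanishes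
  iff \<open>R = \<delta> \<mu>\<^sub>r\<^sub>+\<^sub>1\<close>. The graded Jacobi identity \<open>\<Sum>l\<le>n. [A\<^sub>n\<^sub>-\<^sub>l, \<mu>\<^sub>l] = 0\<close> holds for arbitrary
  biadditive \<open>\<mu>\<^sub>l\<close>; for \<open>n = r + 1\<close> and \<open>\<mu>\<^sub>r\<^sub>+\<^sub>1 = 0\<close> only the summand \<open>[R, \<mu>\<^sub>0]\<close> survives.
\<close>

section \<open>Biadditive maps and Gerstenhaber operations in low degrees\<close>

text \<open>Additivity in each slot carries all computations with associators; scalars enter only
  through \<open>multilinear\<close>.\<close>

definition biadditive :: "('a::ab_group_add list \<Rightarrow> 'a) \<Rightarrow> bool" where
  "biadditive f \<longleftrightarrow> (\<forall>a. additive (\<lambda>x. f [x, a]) \<and> additive (\<lambda>x. f [a, x]))"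

lemma
  assumes "biadditive f"
  shows biadditive_zero_left: "f [0, a] = 0"
    and biadditive_zero_right: "f [a, 0] = 0"
    and biadditive_diff_left: "f [x - y, a] = f [x, a] - f [y, a]"
    and biadditive_diff_right: "f [a, x - y] = f [a, x] - f [a, y]"
    and biadditive_sum_left: "f [sum g S, a] = (\<Sum>s\<in>S. f [g s, a])"
    and biadditive_sum_right: "f [a, sum g S] = (\<Sum>s\<in>S. f [a, g s])"
proof -
  have l: "additive (\<lambda>x. f [x, a])" and r: "additive (\<lambda>x. f [a, x])"
    using assms by (auto simp: biadditive_def)
  show "f [0, a] = 0" "f [x - y, a] = f [x, a] - f [y, a]" 
    "f [sum g S, a] = (\<Sum>s\<in>S. f [g s, a])"
    using additive.zero[OF l] additive.diff[OF l] additive.sum[OF l] by auto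
  show "f [a, 0] = 0" "f [a, x - y] = f [a, x] - f [a, y]" 
    "f [a, sum g S] = (\<Sum>s\<in>S. f [a, g s])"
    using additive.zero[OF r] additive.diff[OF r] additive.sum[OF r] by auto
qed

lemma biadditive_mult_cochain: "biadditive mult_cochain"
  by (simp add: biadditive_def additive_def mult_cochain_def distrib_left distrib_right)

lemma biadditive_zero: "biadditive 0"
  by (simp add: biadditive_def additive_def)

lemma circ_2_2: "gerstenhaber_circ 2 2 f g [a, b, c] = f [g [a, b], c] - f [a, g [b, c]]"
  by (simp add: gerstenhaber_circ_def signed_def numeral_2_eq_2)

lemma circ_eq_0: "length xs + 1 \<noteq> m + n \<Longrightarrow> gerstenhaber_circ m n f g xs = 0"
  by (simp add: gerstenhaber_circ_def)

text \<open>Both shifted degrees are 1, so the sign \<open>-(-1)\<close> makes the bracket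
  symmetric.\<close>

lemma bracket_2_2:
  "gerstenhaber_bracket 2 2 f g xs = gerstenhaber_circ 2 2 f g xs + gerstenhaber_circ 2 2 g f xs"
  by (simp add: gerstenhaber_bracket_def signed_def)

text \<open>Inserting \<open>g\<close> into \<open>f\<close> alternates signs, while the exponents
  for inserting \<open>f\<close> into \<open>g\<close> are even. For \<open>g = mult_cochain\<close>
  this is minus the Hochschild differential of \<open>f\<close>.\<close>

lemma bracket_3_2:
  "gerstenhaber_bracket 3 2 f g [a, b, c, d] =
     f [g [a, b], c, d] - f [a, g [b, c], d] + f [a, b, g [c, d]]
     - g [f [a, b, c], d] - g [a, f [b, c, d]]"
  by (simp add: gerstenhaber_bracket_def gerstenhaber_circ_def signed_def
      numeral_2_eq_2 numeral_3_eq_3 algebra_simps)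

lemma bracket_3_2_eq_0: "length xs \<noteq> 4 \<Longrightarrow> gerstenhaber_bracket 3 2 f g xs = 0"
  by (simp add: gerstenhaber_bracket_def signed_def circ_eq_0)

lemma length_2_E:
  assumes "length xs = 2"
  obtains a b where "xs = [a, b]"
  using assms by (auto simp: numeral_2_eq_2 length_Suc_conv)

lemma length_3_E:
  assumes "length xs = 3"
  obtains a b c where "xs = [a, b, c]"
  using assms by (auto simp: numeral_3_eq_3 length_Suc_conv)

lemma length_4_E:
  assumes "length xs = 4"
  obtains a b c d where "xs = [a, b, c, d]"
  using assms by (auto simp: eval_nat_numeral length_Suc_conv)

lemma cochain_3_eqI:
  assumes "\<And>xs. length xs \<noteq> 3 \<Longrightarrow> F xs = 0" "\<And>xs. length xs \<noteq> 3 \<Longrightarrow> G xs = 0"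
    and "\<And>a b c. F [a, b, c] = G [a, b, c]"
  shows "F = G"
proof
  fix xs show "F xs = G xs"
    using assms by (cases "length xs = 3") (auto elim!: length_3_E)
qed

section \<open>Associator coefficients and their graded Jacobi identity\<close>

text \<open>This is \<open>A\<^sub>n\<close>: on \<open>[a, b, c]\<close> it is the coefficient of
  \<open>\<lambda>\<^sup>n\<close> in \<open>(a * b) * c - a * (b * c)\<close> for the deformed
  product \<open>*\<close>.\<close>

definition assoc_coeff :: "(nat \<Rightarrow> 'a::ab_group_add list \<Rightarrow> 'a) \<Rightarrow> nat \<Rightarrow> 'a list \<Rightarrow> 'a" where
  "assoc_coeff \<mu> n xs = (\<Sum>i\<le>n. gerstenhaber_circ 2 2 (\<mu> i) (\<mu> (n - i)) xs)"

lemma assoc_coeff_eq_0: "length xs \<noteq> 3 \<Longrightarrow> assoc_coeff \<mu> n xs = 0"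
  by (simp add: assoc_coeff_def circ_eq_0)

lemma assoc_coeff_cong: "(\<And>l. l \<le> n \<Longrightarrow> \<mu> l = \<nu> l) \<Longrightarrow> assoc_coeff \<mu> n = assoc_coeff \<nu> n"
  by (auto simp: assoc_coeff_def intro!: ext sum.cong)

lemma finite_weak_compositions_3: "finite {(i, j, k). i + j + k = (n::nat)}"
  by (rule finite_subset[of _ "{..n} \<times> {..n} \<times> {..n}"]) auto

lemma finite_weak_compositions_4: "finite {(i, j, k, l). i + j + k + l = (n::nat)}"
  by (rule finite_subset[of _ "{..n} \<times> {..n} \<times> {..n} \<times> {..n}"]) auto

text \<open>Passes from nested sums to an index set that is symmetric in its three entries.\<close>

lemma sum_weak_compositions_3:
  "(\<Sum>l\<le>n. \<Sum>i\<le>n - l. h l i (n - l - i)) = (\<Sum>(l, i, j) | l + i + j = (n::nat). h l i j)"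
  by (subst sum.Sigma)
    (auto intro!: sum.reindex_bij_witness[of _ "\<lambda>(l, i, j). (l, i)" "\<lambda>(l, i). (l, i, n - l - i)"])

lemma sum_weak_compositions_3_permute:
  fixes n :: nat
  shows "(\<Sum>(i, j, k) | i + j + k = n. h j k i) = (\<Sum>(i, j, k) | i + j + k = n. h i j k)"
    and "(\<Sum>(i, j, k) | i + j + k = n. h j i k) = (\<Sum>(i, j, k) | i + j + k = n. h i j k)"
  by (rule sum.reindex_bij_witness[of _ "\<lambda>(i, j, k). (k, i, j)" "\<lambda>(i, j, k). (j, k, i)"]; auto)
    (rule sum.reindex_bij_witness[of _ "\<lambda>(i, j, k). (j, i, k)" "\<lambda>(i, j, k). (j, i, k)"]; auto)

text \<open>Expansion yields each of the five bracketings of four factors twice, with opposite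
  signs. The order indices differ by a permutation, which the sum over all weak compositions
  absorbs.\<close>

lemma sum_bracket_assoc_coeff:
  assumes bi: "\<And>l. l \<le> n \<Longrightarrow> biadditive (\<mu> l)"
  shows "(\<Sum>l\<le>n. gerstenhaber_bracket 3 2 (assoc_coeff \<mu> (n - l)) (\<mu> l) xs) = 0"
proof (cases "length xs = 4")
  case False
  then show ?thesis by (simp add: bracket_3_2_eq_0)
next
  case True
  then obtain a b c d where xs: "xs = [a, b, c, d]" by (rule length_4_E)
  \<comment> \<open>The five bracketings of \<open>a\<close>, \<open>b\<close>, \<open>c\<close>,
    \<open>d\<close>. Indices run from the outermost product inwards; in \<open>Q\<close> the left
    inner product precedes the right one.\<close>
  define P where "P i j k = \<mu> i [\<mu> j [\<mu> k [a, b], c], d]" for i j k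
  define Q where "Q i j k = \<mu> i [\<mu> j [a, b], \<mu> k [c, d]]" for i j k
  define R where "R i j k = \<mu> i [\<mu> j [a, \<mu> k [b, c]], d]" for i j k
  define S where "S i j k = \<mu> i [a, \<mu> j [\<mu> k [b, c], d]]" for i j k
  define U where "U i j k = \<mu> i [a, \<mu> j [b, \<mu> k [c, d]]]" for i j k
  have "(\<Sum>l\<le>n. gerstenhaber_bracket 3 2 (assoc_coeff \<mu> (n - l)) (\<mu> l) xs) =
    (\<Sum>l\<le>n. \<Sum>i\<le>n - l. P i (n - l - i) l - Q i l (n - l - i) - (R i (n - l - i) l - S i (n - l - i) l)
       + (Q i (n - l - i) l - U i (n - l - i) l) - (P l i (n - l - i) - R l i (n - l - i))
       - (S l i (n - l - i) - U l i (n - l - i)))"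
    unfolding xs bracket_3_2 assoc_coeff_def circ_2_2 P_def Q_def R_def S_def U_def
    by (intro sum.cong refl)
      (simp add: sum.distrib sum_subtractf bi biadditive_sum_left biadditive_sum_right
        biadditive_diff_left biadditive_diff_right)
  also have "\<dots> = (\<Sum>(l, i, j) | l + i + j = n. P i j l - Q i l j - (R i j l - S i j l)
       + (Q i j l - U i j l) - (P l i j - R l i j) - (S l i j - U l i j))"
    by (rule sum_weak_compositions_3)
  \<comment> \<open>A cyclic shift of the indices pairs the terms of \<open>P\<close>,
    \<open>R\<close>, \<open>S\<close> and \<open>U\<close>. The two terms of \<open>Q\<close> also
    need a transposition, because either inner product may come from the associator.\<close>
  also have "\<dots> = 0"
    using sum_weak_compositions_3_permute(1)[of P n] sum_weak_compositions_3_permute(1)[of Q n]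
      sum_weak_compositions_3_permute(1)[of R n] sum_weak_compositions_3_permute(1)[of S n]
      sum_weak_compositions_3_permute(1)[of U n] sum_weak_compositions_3_permute(2)[of Q n]
    by (simp add: case_prod_unfold sum.distrib sum_subtractf)
  finally show ?thesis .
qed

section \<open>Associativity of the power series product in terms of the coefficients\<close>

text \<open>Collecting terms by the total order \<open>s\<close> of the two products and by the
  degrees \<open>p\<close>, \<open>q\<close>, \<open>k\<close> exposes the sums that define
  \<open>assoc_coeff\<close>.\<close>

lemma lambda_ext_left_nth:
  assumes bi: "\<And>l. l \<le> r \<Longrightarrow> biadditive (\<mu> l)" and n: "n \<le> r"
  shows "fps_nth (lambda_ext r \<mu> (lambda_ext r \<mu> F G) H) n =
    (\<Sum>(s, p, q, k) | s + p + q + k = n. \<Sum>l\<le>s. \<mu> l [\<mu> (s - l) [fps_nth F p, fps_nth G q], fps_nth H k])"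
  (is "?L = ?R")
proof -
  have fin: "finite {(m, p, q). m \<le> r \<and> m + p + q = i}" for i
    by (rule finite_subset[OF _ finite_weak_compositions_3[of i]]) auto
  have fin': "finite {(l, i, k). l \<le> r \<and> l + i + k = n}"
    by (rule finite_subset[OF _ finite_weak_compositions_3[of n]]) auto
  have "?L = (\<Sum>(l, i, k) | l \<le> r \<and> l + i + k = n. \<Sum>(m, p, q) | m \<le> r \<and> m + p + q = i.
      \<mu> l [\<mu> m [fps_nth F p, fps_nth G q], fps_nth H k])"
    by (auto simp: lambda_ext_def case_prod_unfold bi biadditive_sum_left intro!: sum.cong)
  also have "\<dots> = (\<Sum>((l, i, k), (m, p, q)) \<in> (SIGMA (l, i, k):{(l, i, k). l \<le> r \<and> l + i + k = n}.
      {(m, p, q). m \<le> r \<and> m + p + q = i}). \<mu> l [\<mu> m [fps_nth F p, fps_nth G q], fps_nth H k])"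
    using fin fin' by (subst sum.Sigma[symmetric]) (auto simp: case_prod_unfold)
  also have "\<dots> = (\<Sum>((s, p, q, k), l) \<in> (SIGMA (s, p, q, k):{(s, p, q, k). s + p + q + k = n}.
      {..s}). \<mu> l [\<mu> (s - l) [fps_nth F p, fps_nth G q], fps_nth H k])"
    \<comment> \<open>The outer and inner products have orders \<open>l\<close> and
      \<open>s - l\<close>. Since \<open>s \<le> n \<le> r\<close>, the truncation at
      \<open>r\<close> cuts nothing off.\<close>
    by (rule sum.reindex_bij_witness[of _ "\<lambda>((s, p, q, k), l). ((l, s - l + p + q, k), (s - l, p, q))"
          "\<lambda>((l, i, k), (m, p, q)). ((l + m, p, q, k), l)"]) (use n in auto)
  also have "\<dots> = ?R"
    using finite_weak_compositions_4[of n] by (subst sum.Sigma[symmetric]) (auto simp: case_prod_unfold)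
  finally show ?thesis .
qed

text \<open>Mirror image of \<open>lambda_ext_left_nth\<close> over the same index set, so that the
  two sums can be subtracted term by term.\<close>

lemma lambda_ext_right_nth:
  assumes bi: "\<And>l. l \<le> r \<Longrightarrow> biadditive (\<mu> l)" and n: "n \<le> r"
  shows "fps_nth (lambda_ext r \<mu> F (lambda_ext r \<mu> G H)) n =
    (\<Sum>(s, p, q, k) | s + p + q + k = n. \<Sum>l\<le>s. \<mu> l [fps_nth F p, \<mu> (s - l) [fps_nth G q, fps_nth H k]])"
  (is "?L = ?R")
proof -
  have fin: "finite {(m, p, q). m \<le> r \<and> m + p + q = i}" for i
    by (rule finite_subset[OF _ finite_weak_compositions_3[of i]]) auto
  have fin': "finite {(l, i, k). l \<le> r \<and> l + i + k = n}"
    by (rule finite_subset[OF _ finite_weak_compositions_3[of n]]) auto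
  have "?L = (\<Sum>(l, p, i) | l \<le> r \<and> l + p + i = n. \<Sum>(m, q, k) | m \<le> r \<and> m + q + k = i.
      \<mu> l [fps_nth F p, \<mu> m [fps_nth G q, fps_nth H k]])"
    by (auto simp: lambda_ext_def case_prod_unfold bi biadditive_sum_right intro!: sum.cong)
  also have "\<dots> = (\<Sum>((l, p, i), (m, q, k)) \<in> (SIGMA (l, p, i):{(l, p, i). l \<le> r \<and> l + p + i = n}.
      {(m, q, k). m \<le> r \<and> m + q + k = i}). \<mu> l [fps_nth F p, \<mu> m [fps_nth G q, fps_nth H k]])"
    using fin fin' by (subst sum.Sigma[symmetric]) (auto simp: case_prod_unfold)
  also have "\<dots> = (\<Sum>((s, p, q, k), l) \<in> (SIGMA (s, p, q, k):{(s, p, q, k). s + p + q + k = n}.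
      {..s}). \<mu> l [fps_nth F p, \<mu> (s - l) [fps_nth G q, fps_nth H k]])"
    by (rule sum.reindex_bij_witness[of _ "\<lambda>((s, p, q, k), l). ((l, p, s - l + q + k), (s - l, q, k))"
          "\<lambda>((l, p, i), (m, q, k)). ((l + m, p, q, k), l)"]) (use n in auto)
  also have "\<dots> = ?R"
    using finite_weak_compositions_4[of n] by (subst sum.Sigma[symmetric]) (auto simp: case_prod_unfold)
  finally show ?thesis .
qed

lemma lambda_ext_associator_nth:
  assumes bi: "\<And>l. l \<le> r \<Longrightarrow> biadditive (\<mu> l)" and n: "n \<le> r"
  shows "fps_nth (lambda_ext r \<mu> (lambda_ext r \<mu> F G) H) n
      - fps_nth (lambda_ext r \<mu> F (lambda_ext r \<mu> G H)) n =
    (\<Sum>(s, p, q, k) | s + p + q + k = n. assoc_coeff \<mu> s [fps_nth F p, fps_nth G q, fps_nth H k])"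
  by (simp add: lambda_ext_left_nth[OF bi n] lambda_ext_right_nth[OF bi n] case_prod_unfold assoc_coeff_def circ_2_2 sum_subtractf)

text \<open>The associator of three series is a convolution of the \<open>assoc_coeff\<close>
  values, so it vanishes with them. Conversely, evaluating at constant series isolates a single
  coefficient.\<close>

lemma assoc_up_to_iff:
  assumes bi: "\<And>l. l \<le> r \<Longrightarrow> biadditive (\<mu> l)"
  shows "assoc_up_to r \<mu> \<longleftrightarrow> (\<forall>n\<le>r. assoc_coeff \<mu> n = 0)"
proof
  assume coeff: "\<forall>n\<le>r. assoc_coeff \<mu> n = 0"
  show "assoc_up_to r \<mu>"
    unfolding assoc_up_to_def
  proof (intro allI impI)
    fix F G H n assume "n < r + 1"
    then have n: "n \<le> r" by simp
    have "(\<Sum>(s, p, q, k) | s + p + q + k = n.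
        assoc_coeff \<mu> s [fps_nth F p, fps_nth G q, fps_nth H k]) = 0"
      using coeff n by (auto intro!: sum.neutral)
    then show "fps_nth (lambda_ext r \<mu> (lambda_ext r \<mu> F G) H) n =
        fps_nth (lambda_ext r \<mu> F (lambda_ext r \<mu> G H)) n"
      by (simp flip: lambda_ext_associator_nth[OF bi n])
  qed
next
  assume assoc: "assoc_up_to r \<mu>"
  show "\<forall>n\<le>r. assoc_coeff \<mu> n = 0"
  proof (intro allI impI)
    fix n assume n: "n \<le> r"
    have "assoc_coeff \<mu> n [a, b, c] = 0" for a b c
    proof -
      \<comment> \<open>If some degree is positive, that argument is a zero coefficient of a
        constant series. Hence only \<open>(n, 0, 0, 0)\<close> contributes to the sum
        below.\<close>
      have zero: "assoc_coeff \<mu> s [fps_nth (fps_const a) p, fps_nth (fps_const b) q, fps_nth (fps_const c) k] = 0"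
        if "s \<le> n" "(p, q, k) \<noteq> (0, 0, 0)" for s p q k
      proof -
        have "biadditive (\<mu> l)" if "l \<le> s" for l
          using bi n \<open>s \<le> n\<close> that by simp
        then show ?thesis
          using \<open>(p, q, k) \<noteq> (0, 0, 0)\<close>
          by (auto simp: assoc_coeff_def circ_2_2 biadditive_zero_left biadditive_zero_right)
      qed
      have "assoc_coeff \<mu> n [a, b, c] = (\<Sum>(s, p, q, k)\<in>{(n, 0, 0, 0)}.
          assoc_coeff \<mu> s [fps_nth (fps_const a) p, fps_nth (fps_const b) q, fps_nth (fps_const c) k])"
        by simp
      also have "\<dots> = (\<Sum>(s, p, q, k) | s + p + q + k = n.
          assoc_coeff \<mu> s [fps_nth (fps_const a) p, fps_nth (fps_const b) q, fps_nth (fps_const c) k])"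
      proof (rule sum.mono_neutral_left[OF finite_weak_compositions_4])
        show "\<forall>x\<in>{(s, p, q, k). s + p + q + k = n} - {(n, 0, 0, 0)}. (case x of (s, p, q, k) \<Rightarrow>
            assoc_coeff \<mu> s [fps_nth (fps_const a) p, fps_nth (fps_const b) q, fps_nth (fps_const c) k]) = 0"
        proof
          fix x assume x: "x \<in> {(s, p, q, k). s + p + q + k = n} - {(n, 0, 0, 0)}"
          obtain s p q k where spqk: "x = (s, p, q, k)" by (cases x)
          with x have "s \<le> n" "(p, q, k) \<noteq> (0, 0, 0)" by auto
          then show "(case x of (s, p, q, k) \<Rightarrow>
            assoc_coeff \<mu> s [fps_nth (fps_const a) p, fps_nth (fps_const b) q, fps_nth (fps_const c) k]) = 0"
            unfolding spqk prod.case by (rule zero)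
        qed
      qed auto
      also have "\<dots> = 0"
        using assoc n lambda_ext_associator_nth[of r \<mu> n "fps_const a" "fps_const b" "fps_const c"] bi
        by (simp add: assoc_up_to_def del: fps_nth_fps_const)
      finally show ?thesis .
    qed
    then show "assoc_coeff \<mu> n = 0"
      by (intro cochain_3_eqI) (auto simp: assoc_coeff_eq_0)
  qed
qed

section \<open>The next order: extension equation and cocycle condition\<close>

text \<open>The part of \<open>A\<^sub>r\<^sub>+\<^sub>1\<close> that does not involve \<open>\<mu>\<^sub>r\<^sub>+\<^sub>1\<close>.\<close>

definition inner_coeff :: "(nat \<Rightarrow> 'a::ab_group_add list \<Rightarrow> 'a) \<Rightarrow> nat \<Rightarrow> 'a list \<Rightarrow> 'a" where
  "inner_coeff \<mu> r xs = (\<Sum>l=1..r. gerstenhaber_circ 2 2 (\<mu> l) (\<mu> (r + 1 - l)) xs)"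

text \<open>The new cochain \<open>\<nu>\<close> occurs only in the summands \<open>i = 0\<close>
  and \<open>i = r + 1\<close>, where it is composed with \<open>mult_cochain\<close> in the two
  possible orders. By \<open>bracket_2_2\<close> these add up to the bracket.\<close>

lemma assoc_coeff_Suc:
  assumes "\<mu> 0 = mult_cochain"
  shows "assoc_coeff (\<mu>(r + 1 := \<nu>)) (r + 1) =
    inner_coeff \<mu> r + gerstenhaber_bracket 2 2 \<nu> mult_cochain"
proof
  fix xs
  have "{..r + 1} = insert 0 (insert (r + 1) {1..r})" by auto
  then show "assoc_coeff (\<mu>(r + 1 := \<nu>)) (r + 1) xs =
    (inner_coeff \<mu> r + gerstenhaber_bracket 2 2 \<nu> mult_cochain) xs"
    using assms by (auto simp: assoc_coeff_def inner_coeff_def bracket_2_2 add_ac intro!: sum.cong)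
qed

text \<open>Coefficients up to order \<open>r\<close> do not see \<open>\<nu>\<close>, so the
  extension adds one equation, whose right-hand side is a component of
  \<open>delta_N 2\<close>.\<close>

lemma assoc_up_to_fun_upd_iff:
  assumes "\<mu> 0 = mult_cochain" and bi: "\<And>l. l \<le> r \<Longrightarrow> biadditive (\<mu> l)" and "biadditive \<nu>"
  shows "assoc_up_to (r + 1) (\<mu>(r + 1 := \<nu>)) \<longleftrightarrow>
    assoc_up_to r \<mu> \<and> inner_coeff \<mu> r = - gerstenhaber_bracket 2 2 \<nu> mult_cochain"
proof -
  have coeff: "assoc_coeff (\<mu>(r + 1 := \<nu>)) n = assoc_coeff \<mu> n" if "n \<le> r" for n
    using that by (intro assoc_coeff_cong) auto
  have "biadditive ((\<mu>(r + 1 := \<nu>)) l)" if "l \<le> r + 1" for l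
    using assms that by auto
  then have "assoc_up_to (r + 1) (\<mu>(r + 1 := \<nu>)) \<longleftrightarrow>
      (\<forall>n\<le>r + 1. assoc_coeff (\<mu>(r + 1 := \<nu>)) n = 0)"
    by (rule assoc_up_to_iff)
  also have "\<dots> \<longleftrightarrow> (\<forall>n\<le>r. assoc_coeff \<mu> n = 0) \<and> assoc_coeff (\<mu>(r + 1 := \<nu>)) (r + 1) = 0"
    using coeff by (auto simp: le_Suc_eq)
  also have "\<dots> \<longleftrightarrow> assoc_up_to r \<mu> \<and> assoc_coeff (\<mu>(r + 1 := \<nu>)) (r + 1) = 0"
    using bi by (simp add: assoc_up_to_iff)
  finally show ?thesis
    unfolding assoc_coeff_Suc[of \<mu>, OF assms(1)] by (simp add: eq_neg_iff_add_eq_0)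
qed

lemma bracket_inner_coeff:
  assumes "\<mu> 0 = mult_cochain" and bi: "\<And>l. l \<le> r \<Longrightarrow> biadditive (\<mu> l)" and "assoc_up_to r \<mu>"
  shows "gerstenhaber_bracket 3 2 (inner_coeff \<mu> r) mult_cochain = 0"
proof
  fix xs
  define \<mu>' where "\<mu>' = \<mu>(r + 1 := 0)"
  have bi': "biadditive (\<mu>' l)" if "l \<le> r + 1" for l
    using bi that by (auto simp: \<mu>'_def biadditive_zero)
  \<comment> \<open>With the zero cochain in order \<open>r + 1\<close>, the bracket term of
    \<open>assoc_coeff_Suc\<close> disappears.\<close>
  have "inner_coeff \<mu> r = assoc_coeff \<mu>' (r + 1)"
    unfolding \<mu>'_def assoc_coeff_Suc[of \<mu>, OF assms(1)]
    by (intro cochain_3_eqI) (auto simp: inner_coeff_def circ_eq_0 bracket_2_2 circ_2_2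
        biadditive_zero_left[OF biadditive_mult_cochain] biadditive_zero_right[OF biadditive_mult_cochain])
  moreover have "\<mu>' 0 = mult_cochain"
    using assms(1) by (simp add: \<mu>'_def)
  ultimately have "gerstenhaber_bracket 3 2 (inner_coeff \<mu> r) mult_cochain xs =
    (\<Sum>l\<in>{0}. gerstenhaber_bracket 3 2 (assoc_coeff \<mu>' (r + 1 - l)) (\<mu>' l) xs)"
    by simp
  also have "\<dots> = (\<Sum>l\<le>r + 1. gerstenhaber_bracket 3 2 (assoc_coeff \<mu>' (r + 1 - l)) (\<mu>' l) xs)"
  proof (rule sum.mono_neutral_left)
    \<comment> \<open>For \<open>l \<ge> 1\<close> the associator coefficient has order at most
      \<open>r\<close>, hence is zero. Its bracket with \<open>\<mu>' l\<close> then vanishes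
      because \<open>\<mu>' l\<close> is biadditive.\<close>
    show "\<forall>l\<in>{..r + 1} - {0}. gerstenhaber_bracket 3 2 (assoc_coeff \<mu>' (r + 1 - l)) (\<mu>' l) xs = 0"
    proof
      fix l assume l: "l \<in> {..r + 1} - {0}"
      then have "assoc_coeff \<mu>' (r + 1 - l) = assoc_coeff \<mu> (r + 1 - l)"
        by (intro assoc_coeff_cong) (auto simp: \<mu>'_def)
      also have "\<dots> = 0"
        using assms(3) l by (auto simp: assoc_up_to_iff[OF bi])
      finally show "gerstenhaber_bracket 3 2 (assoc_coeff \<mu>' (r + 1 - l)) (\<mu>' l) xs = 0"
        using bi'[of l] l
        by (cases "length xs = 4") (auto simp: bracket_3_2_eq_0 bracket_3_2 biadditive_zero_left
            biadditive_zero_right elim!: length_4_E)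
    qed
  qed auto
  also have "\<dots> = 0"
    using bi' by (rule sum_bracket_assoc_coeff)
  finally show "gerstenhaber_bracket 3 2 (inner_coeff \<mu> r) mult_cochain xs = 0 xs"
    by simp
qed

section \<open>Multilinearity and closure properties of coisotropic cochains\<close>

lemma all_length_2_index_iff:
  "(\<forall>xs i. length xs = 2 \<longrightarrow> i < (2::nat) \<longrightarrow> P xs i) \<longleftrightarrow> (\<forall>a b. P [a, b] 0 \<and> P [a, b] 1)"
  by (auto simp: eval_nat_numeral length_Suc_conv less_Suc_eq)

lemma all_length_3_index_iff:
  "(\<forall>xs i. length xs = 3 \<longrightarrow> i < (3::nat) \<longrightarrow> P xs i) \<longleftrightarrow>
    (\<forall>a b c. P [a, b, c] 0 \<and> P [a, b, c] 1 \<and> P [a, b, c] 2)"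
  by (auto simp: eval_nat_numeral length_Suc_conv less_Suc_eq)

lemma multilinear_2_iff:
  "multilinear scale 2 f \<longleftrightarrow>
    (\<forall>a. module_hom scale scale (\<lambda>x. f [x, a]) \<and> module_hom scale scale (\<lambda>x. f [a, x])) \<and>
    (\<forall>xs. length xs \<noteq> 2 \<longrightarrow> f xs = 0)"
  unfolding multilinear_def all_length_2_index_iff by auto

lemma multilinear_3_iff:
  "multilinear scale 3 f \<longleftrightarrow>
    (\<forall>a b. module_hom scale scale (\<lambda>x. f [x, a, b]) \<and> module_hom scale scale (\<lambda>x. f [a, x, b]) \<and>
      module_hom scale scale (\<lambda>x. f [a, b, x])) \<and>
    (\<forall>xs. length xs \<noteq> 3 \<longrightarrow> f xs = 0)"
  unfolding multilinear_def all_length_3_index_iff by (simp add: numeral_2_eq_2) blast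

lemma multilinear_biadditive: "multilinear scale 2 f \<Longrightarrow> biadditive f"
  by (simp add: multilinear_2_iff biadditive_def additive_def module_hom_iff)

lemma multilinear_circ:
  assumes "multilinear scale 2 f" "multilinear scale 2 g"
  shows "multilinear scale 3 (gerstenhaber_circ 2 2 f g)"
  using assms
  by (auto simp: multilinear_2_iff multilinear_3_iff circ_2_2 circ_eq_0 module_hom_iff
      module.scale_right_diff_distrib)

lemma multilinear_sum:
  assumes "module scale" and "\<And>l. l \<in> S \<Longrightarrow> multilinear scale n (f l)"
  shows "multilinear scale n (\<lambda>xs. \<Sum>l\<in>S. f l xs)"
  using assms
  by (auto simp: multilinear_def module_hom_iff sum.distrib module.scale_sum_right)

lemma (in unital_algebra) multilinear_mult_cochain: "multilinear scale 2 mult_cochain"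
  by (auto simp: multilinear_2_iff mult_cochain_def module_hom_iff module_axioms distrib_left
      distrib_right scale_mult_left scale_mult_right split: list.splits)

context coisotropic_algebra
begin

text \<open>Compatibility with \<open>\<iota>\<close> is its multiplicativity; the condition on
  \<open>A0\<close> is the ideal property.\<close>

lemma mu0_C_N: "mu0 \<in> C_N 2"
  by (auto simp: C_N_def mu0_def tot.multilinear_mult_cochain N.multilinear_mult_cochain
      mult_cochain_def iota_mult A0_left A0_right elim!: length_2_E)

text \<open>An argument from \<open>A0\<close> either enters the outer map directly or puts the
  inner value into \<open>A0\<close>. So both terms of the composition lie in \<open>A0\<close>, and
  so does their difference.\<close>

lemma circ_C_N:
  assumes "f \<in> C_N 2" "g \<in> C_N 2"
  shows "(gerstenhaber_circ 2 2 (fst f) (fst g), gerstenhaber_circ 2 2 (snd f) (snd g)) \<in> C_N 3"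
proof -
  have iota: "fst h [\<iota> a, \<iota> b] = \<iota> (snd h [a, b])" if "h \<in> C_N 2" for h a b
    using that by (auto simp: C_N_def dest!: spec[of _ "[a, b]"])
  have A0: "snd h [a, b] \<in> A0" if "h \<in> C_N 2" "a \<in> A0 \<or> b \<in> A0" for h a b
    using that by (auto simp: C_N_def dest!: spec[of _ "[a, b]"])
  have "multilinear scale_tot 3 (gerstenhaber_circ 2 2 (fst f) (fst g))"
    "multilinear scale_N 3 (gerstenhaber_circ 2 2 (snd f) (snd g))"
    using assms by (auto simp: C_N_def intro!: multilinear_circ)
  moreover have "gerstenhaber_circ 2 2 (fst f) (fst g) (map \<iota> xs) =
      \<iota> (gerstenhaber_circ 2 2 (snd f) (snd g) xs)" if "length xs = 3" for xs
    using that assms by (auto simp: circ_2_2 iota iota.diff elim!: length_3_E)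
  moreover have "gerstenhaber_circ 2 2 (snd f) (snd g) xs \<in> A0"
    if "length xs = 3" "set xs \<inter> A0 \<noteq> {}" for xs
    using that assms by (auto simp: circ_2_2 A0 elim!: length_3_E intro!: N.subspace_diff[OF A0_subspace])
  ultimately show ?thesis
    by (auto simp: C_N_def)
qed

lemma sum_C_N:
  assumes "\<And>l. l \<in> S \<Longrightarrow> (f l, g l) \<in> C_N n"
  shows "(\<lambda>xs. \<Sum>l\<in>S. f l xs, \<lambda>xs. \<Sum>l\<in>S. g l xs) \<in> C_N n"
  using assms
  by (auto simp: C_N_def iota.sum tot.module_axioms N.module_axioms
      intro!: multilinear_sum N.subspace_sum[OF A0_subspace])

end

section \<open>The obstruction and the extension criterion\<close>

text \<open>The reflection of \<open>l\<close> to \<open>r + 1 - l\<close> exchanges the two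
  compositions in each bracket, so the sum of brackets is twice \<open>inner_coeff\<close>, and
  \<open>q (1/2)\<close> halves it.\<close>

lemma scale_half_sum_bracket:
  assumes "rat_embedding q" "module scale"
  shows "scale (q (1/2)) (\<Sum>l=1..r. gerstenhaber_bracket 2 2 (\<mu> l) (\<mu> (r + 1 - l)) xs) =
    inner_coeff \<mu> r xs"
proof -
  interpret module scale by fact
  have "(\<Sum>l=1..r. gerstenhaber_circ 2 2 (\<mu> (r + 1 - l)) (\<mu> l) xs) = inner_coeff \<mu> r xs"
    unfolding inner_coeff_def
    by (rule sum.reindex_bij_witness[of _ "\<lambda>l. r + 1 - l" "\<lambda>l. r + 1 - l"]) auto
  then have "(\<Sum>l=1..r. gerstenhaber_bracket 2 2 (\<mu> l) (\<mu> (r + 1 - l)) xs) =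
    inner_coeff \<mu> r xs + inner_coeff \<mu> r xs"
    by (simp add: bracket_2_2 sum.distrib inner_coeff_def)
  moreover have "q (1/2) + q (1/2) = 1"
    using assms(1) unfolding rat_embedding_def by (metis field_sum_of_halves)
  ultimately show ?thesis
    by (metis scale_left_distrib scale_one scale_right_distrib)
qed

theorem theorem4p20:
  fixes q :: "rat \<Rightarrow> 'k::comm_ring_1"
    and scale_tot :: "'k \<Rightarrow> 'a::{ring, monoid_mult} \<Rightarrow> 'a"
    and scale_N :: "'k \<Rightarrow> 'b::{ring, monoid_mult} \<Rightarrow> 'b"
    and \<iota> :: "'b \<Rightarrow> 'a" and A0 :: "'b set"
    and r :: nat and \<mu> :: "nat \<Rightarrow> ('a, 'b) cochain_pair"
  assumes "rat_embedding q"
    and "coisotropic_algebra scale_tot scale_N \<iota> A0"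
    and "coisotropic_algebra.assoc_deformation scale_tot scale_N \<iota> A0 r \<mu>"
  defines "C \<equiv> coisotropic_algebra.C_N scale_tot scale_N \<iota> A0"
    and "R \<equiv> coisotropic_algebra.obstruction scale_tot scale_N q r \<mu>"
  shows "R \<in> C 3 \<and> delta_N 3 R = 0 \<and>
    (coisotropic_algebra.extendable scale_tot scale_N \<iota> A0 r \<mu> \<longleftrightarrow>
       (\<exists>\<nu>\<in>C 2. R = delta_N 2 \<nu>)) \<and>
    (\<forall>\<nu>\<in>C 2. R = delta_N 2 \<nu> \<longrightarrow>
       coisotropic_algebra.assoc_deformation scale_tot scale_N \<iota> A0 (r + 1) (\<mu>(r + 1 := \<nu>)))"
proof -
  interpret coisotropic_algebra scale_tot scale_N \<iota> A0 by fact
  let ?t = "\<lambda>l. fst (\<mu> l)" and ?n = "\<lambda>l. snd (\<mu> l)"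
  have R: "R = (inner_coeff ?t r, inner_coeff ?n r)"
    unfolding R_def obstruction_def
    by (simp only: scale_half_sum_bracket[OF assms(1) tot.module_axioms, of ?t]
        scale_half_sum_bracket[OF assms(1) N.module_axioms, of ?n])
  have \<mu>_0: "\<mu> 0 = mu0" and \<mu>_Suc: "\<And>l. l \<in> {1..r} \<Longrightarrow> \<mu> l \<in> C_N 2"
    and assoc: "assoc_up_to r ?t" "assoc_up_to r ?n"
    using assms(3) by (auto simp: assoc_deformation_def)
  \<comment> \<open>The definition of a deformation gives membership only for
    \<open>l \<ge> 1\<close>; order 0 is supplied by \<open>mu0_C_N\<close>.\<close>
  have \<mu>_C_N: "\<mu> l \<in> C_N 2" if "l \<le> r" for l
    using \<mu>_0 \<mu>_Suc[of l] mu0_C_N that by (cases l) auto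
  have bi: "biadditive (fst f)" "biadditive (snd f)" if "f \<in> C_N 2" for f
    using that by (auto simp: C_N_def dest: multilinear_biadditive)
  have zero: "?t 0 = mult_cochain" "?n 0 = mult_cochain"
    using \<mu>_0 by (auto simp: mu0_def)
  have R_C: "R \<in> C 3"
    \<comment> \<open>Both \<open>l\<close> and \<open>r + 1 - l\<close> lie between 1 and
      \<open>r\<close>, so every composition in the sum is one of coisotropic cochains.\<close>
    unfolding R C_def inner_coeff_def[abs_def]
    by (intro sum_C_N circ_C_N \<mu>_C_N) auto
  have cocycle: "delta_N 3 R = 0"
    using bracket_inner_coeff[of ?t, OF zero(1) bi(1)[OF \<mu>_C_N] assoc(1)]
      bracket_inner_coeff[of ?n, OF zero(2) bi(2)[OF \<mu>_C_N] assoc(2)]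
    by (simp add: R delta_N_def bracket_N_def mu0_def zero_prod_def)
  \<comment> \<open>An equivalence for each fixed \<open>\<nu>\<close> gives both the extension
    criterion and the claim that every solution extends the deformation.\<close>
  have extension: "assoc_deformation (r + 1) (\<mu>(r + 1 := \<nu>)) \<longleftrightarrow> R = delta_N 2 \<nu>"
    if "\<nu> \<in> C_N 2" for \<nu>
  proof -
    have "(\<lambda>l. fst ((\<mu>(r + 1 := \<nu>)) l)) = ?t(r + 1 := fst \<nu>)"
      "(\<lambda>l. snd ((\<mu>(r + 1 := \<nu>)) l)) = ?n(r + 1 := snd \<nu>)"
      by auto
    moreover have "\<forall>l\<in>{1..r + 1}. (\<mu>(r + 1 := \<nu>)) l \<in> C_N 2"
      using \<mu>_C_N that by auto
    ultimately show ?thesis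
      using \<mu>_0 assoc assoc_up_to_fun_upd_iff[of ?t, OF zero(1) bi(1)[OF \<mu>_C_N] bi(1)[OF that]]
        assoc_up_to_fun_upd_iff[of ?n, OF zero(2) bi(2)[OF \<mu>_C_N] bi(2)[OF that]]
      unfolding assoc_deformation_def
      by (simp add: R delta_N_def bracket_N_def mu0_def)
  qed
  show ?thesis
    using R_C cocycle extension by (auto simp: C_def extendable_def)
qed

end
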